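(* The $1/4$ approximation ratio is tight for the ApproxMaxCRS algorithm. That is, there is no constant $\alpha>1/4$ such that on every instance $(O,w,d)$ of the MaxCRS problem the point $\hat p$ returned by ApproxMaxCRS is guaranteed to satisfy $$\sum_{o\in O_{c(\hat p)}}w(o)\;\ge\;\alpha\,\max_{p\in\mathbb{R}^2}\ \sum_{o\in O_{c(p)}}w(o).$$
   Context: MaxCRS problem. Given a finite set $O$ of points (objects) in $\mathbb{R}^2$ with weights $w(o)\ge0$ and a diameter $d>0$, find a location $p\in\mathbb{R}^2$ maximizing $\sum_{o\in O_{c(p)}}w(o)$, where $c(p)$ is the circular region of diameter $d$ centered at $p$ and $O_{c(p)}$ is the set of objects covered by $c(p)$. Objects on the boundary of a region are not covered, so $c(p)$ is effectively an open disk. Algorithm ApproxMaxCRS. Let $C$ be the set of open disks of diameter $d$ centered at the objects $o\in O$, the disk at $o$ having weight $w(o)$. Let $R$ be the set of their minimum bounding rectangles, i.e. the open axis-parallel $d\times d$ squares centered at the objects, with the same weights. The location-weight of a point with respect to $R$ is the sum of the weights of the members of $R$ covering it. A max-region with regard to $R$ is a rectangle $\rho$ all of whose points have the same location-weight $\tau$ with respect to $R$, such that no point of the plane has location-weight higher than $\tau$. The algorithm: (1) computes a max-region $\rho$ with regard to $R$ (using the exact algorithm ExactMaxRS; if there are several max-regions, any of them may be the one computed); (2) lets $p_0$ be the center of $\rho$; (3) forms four shifted points $p_1,\dots,p_4$ at distance $\sigma$ from $p_0$ in the four diagonal directions, i.e. the points $p_0+(\pm\sigma/\sqrt2,\pm\sigma/\sqrt2)$,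 where the shifting distance $\sigma$ is any fixed value with $(\sqrt2-1)\frac d2<\sigma<\frac d2$; (4) returns a point $\hat p$ among $p_0,\dots,p_4$ that maximizes the total weight of the disks in $C$ covering it. *)

theory Defs
  imports "HOL-Analysis.Analysis"
begin

definition maxcrs_instance :: "(real^2) set \<Rightarrow> (real^2 \<Rightarrow> real) \<Rightarrow> real \<Rightarrow> bool" where
  "maxcrs_instance Obj w d \<longleftrightarrow> finite Obj \<and> (\<forall>x\<in>Obj. w x \<ge> 0) \<and> d > 0"

definition covered_weight :: "(real^2) set \<Rightarrow> (real^2 \<Rightarrow> real) \<Rightarrow> real \<Rightarrow> real^2 \<Rightarrow> real" where
  "covered_weight Obj w d p = (\<Sum>x | x \<in> Obj \<and> x \<in> ball p (d / 2). w x)"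

text \<open>
  For finite \<open>Obj\<close> only finitely many values are attained (lemma below), so \<open>Max\<close> is the
  genuine maximum over the plane.
\<close>

definition maxcrs_opt :: "(real^2) set \<Rightarrow> (real^2 \<Rightarrow> real) \<Rightarrow> real \<Rightarrow> real" where
  "maxcrs_opt Obj w d = Max (range (covered_weight Obj w d))"

lemma finite_range_covered_weight:
  assumes "finite Obj"
  shows "finite (range (covered_weight Obj w d))"
proof (rule finite_subset)
  show "range (covered_weight Obj w d) \<subseteq> sum w ` Pow Obj"
    unfolding covered_weight_def by auto
  show "finite (sum w ` Pow Obj)"
    using assms by simp
qed

definition disk_weight :: "(real^2) set \<Rightarrow> (real^2 \<Rightarrow> real) \<Rightarrow> real \<Rightarrow> real^2 \<Rightarrow> real" where
  "disk_weight Obj w d p = (\<Sum>x | x \<in> Obj \<and> p \<in> ball x (d / 2). w x)"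

definition mbr :: "real \<Rightarrow> real^2 \<Rightarrow> (real^2) set" where
  "mbr d x = box (x - vec (d / 2)) (x + vec (d / 2))"

text \<open>
  Distinct objects have distinct squares, so the weighted squares are indexed by their centers.
\<close>

definition location_weight :: "(real^2) set \<Rightarrow> (real^2 \<Rightarrow> real) \<Rightarrow> real \<Rightarrow> real^2 \<Rightarrow> real" where
  "location_weight Obj w d p = (\<Sum>x | x \<in> Obj \<and> p \<in> mbr d x. w x)"

text \<open>
  A rectangle is a nonempty open axis-parallel box, given by its lower left corner \<open>a\<close> and
  upper right corner \<open>b\<close>.  Since the squares are open, closed nondegenerate rectangles
  would lead to the same set of possible centers.
\<close>

definition max_region ::
    "(real^2) set \<Rightarrow> (real^2 \<Rightarrow> real) \<Rightarrow> real \<Rightarrow> real^2 \<Rightarrow> real^2 \<Rightarrow> bool" where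
  "max_region Obj w d a b \<longleftrightarrow>
     box a b \<noteq> {} \<and>
     (\<exists>\<tau>. (\<forall>p\<in>box a b. location_weight Obj w d p = \<tau>) \<and>
          (\<forall>q. location_weight Obj w d q \<le> \<tau>))"

definition shifted_points :: "real \<Rightarrow> real^2 \<Rightarrow> (real^2) set" where
  "shifted_points \<sigma> p0 =
     {p0 + vector [s * (\<sigma> / sqrt 2), t * (\<sigma> / sqrt 2)] | s t. s \<in> {-1, 1} \<and> t \<in> {-1, 1}}"

text \<open>
  The algorithm is nondeterministic, both in the max-region and in the choice between
  equally good candidates; the predicate holds for every point it may return.
\<close>

definition approx_maxcrs_returns ::
    "real \<Rightarrow> (real^2) set \<Rightarrow> (real^2 \<Rightarrow> real) \<Rightarrow> real \<Rightarrow> real^2 \<Rightarrow> bool" where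
  "approx_maxcrs_returns \<sigma> Obj w d p \<longleftrightarrow>
     (\<exists>a b p0. max_region Obj w d a b \<and> p0 = midpoint a b \<and>
        is_arg_max (disk_weight Obj w d) (\<lambda>q. q \<in> insert p0 (shifted_points \<sigma> p0)) p)"

end

theory Submission
  imports Defs
begin

text \<open>
  For \<open>d = 2\<close>, put unit weights at the four corners \<open>(\<plusminus>3/4, \<plusminus>3/4)\<close> and weight 4 at one distant
  point.  The four squares meet in a box centered at the origin whose location-weight 4 ties with
  that of the distant point, so the algorithm may choose it.  Any candidate then lies on
  a diagonal through the origin, and its unit disk contains at most one corner, whereas the optimum
  is at least 4.
\<close>

lemma vector2_eq_iff:
  "(vector [a, b] :: 'a::zero^2) = vector [c, d] \<longleftrightarrow> a = c \<and> b = d"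
  by (auto simp: vec_eq_iff forall_2)

text \<open>Puts an arbitrary point into the coordinate form that the membership criteria
  expect.\<close>

lemma vector2_eta: "(vector [p $ 1, p $ 2] :: 'a::zero^2) = p"
  by (simp add: vec_eq_iff forall_2)

lemma vector2_in_unit_ball_iff:
  "(vector [x, y] :: real^2) \<in> ball (vector [a, b]) 1 \<longleftrightarrow> (x - a)\<^sup>2 + (y - b)\<^sup>2 < 1"
  by (simp add: dist_vec_def L2_set_def UNIV_2 dist_real_def power2_commute)

lemma vector2_in_mbr_iff:
  "(vector [x, y] :: real^2) \<in> mbr 2 (vector [a, b]) \<longleftrightarrow> \<bar>x - a\<bar> < 1 \<and> \<bar>y - b\<bar> < 1"
  by (auto simp: mbr_def mem_box_cart forall_2)

lemma covered_weight_eq_disk_weight: "covered_weight = disk_weight"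
  by (intro ext) (simp add: covered_weight_def disk_weight_def dist_commute)

text \<open>The corner coordinate c = 3/4 satisfies c < 1, so the four squares of half-side 1
  overlap around the origin, and 2 * c^2 > 1, so the unit disks about the corners miss the
  origin.\<close>

definition tight_objects :: "(real^2) set" where
  "tight_objects = {vector [3/4, 3/4], vector [3/4, - (3/4)], vector [- (3/4), 3/4],
     vector [- (3/4), - (3/4)], vector [10, 10]}"

definition tight_weight :: "real^2 \<Rightarrow> real" where
  "tight_weight x = (if x = vector [10, 10] then 4 else 1)"

text \<open>Stated for an arbitrary \<open>P\<close> so that it evaluates location weights, disk
  weights and covered weights alike.\<close>

lemma sum_tight_weight:
  "(\<Sum>x | x \<in> tight_objects \<and> P x. tight_weight x) =
     of_bool (P (vector [3/4, 3/4])) + of_bool (P (vector [3/4, - (3/4)])) +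
     of_bool (P (vector [- (3/4), 3/4])) + of_bool (P (vector [- (3/4), - (3/4)])) +
     4 * of_bool (P (vector [10, 10]))"
proof -
  have "finite tight_objects"
    by (simp add: tight_objects_def)
  then have "(\<Sum>x | x \<in> tight_objects \<and> P x. tight_weight x) =
      (\<Sum>x\<in>tight_objects. if P x then tight_weight x else 0)"
    by (rule sum.inter_filter)
  then show ?thesis
    by (simp add: tight_objects_def tight_weight_def vector2_eq_iff)
qed

text \<open>The corner squares have coordinates below 7/4 and the distant square has coordinates
  above 9, so no point collects weight from both groups, and each group weighs 4.\<close>

lemma location_weight_tight_le: "location_weight tight_objects tight_weight 2 q \<le> 4"
proof -
  have "location_weight tight_objects tight_weight 2 (vector [q $ 1, q $ 2]) \<le> 4"
    unfolding location_weight_def sum_tight_weight vector2_in_mbr_iff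
    by (auto simp: of_bool_def)
  then show ?thesis
    by (simp only: vector2_eta)
qed

lemma max_region_tight:
  "max_region tight_objects tight_weight 2 (vector [- (1/4), - (1/4)]) (vector [1/4, 1/4])"
proof -
  have "location_weight tight_objects tight_weight 2 p = 4"
    if "p \<in> box (vector [- (1/4), - (1/4)]) (vector [1/4, 1/4])" for p
  proof -
    \<comment> \<open>The interval of radius 1 about 3/4 and the one about -3/4 meet exactly in
      (-1/4, 1/4).\<close>
    have "\<bar>p $ 1\<bar> < 1/4" "\<bar>p $ 2\<bar> < 1/4"
      using that by (auto simp: mem_box_cart forall_2)
    then have "location_weight tight_objects tight_weight 2 (vector [p $ 1, p $ 2]) = 4"
      unfolding location_weight_def sum_tight_weight vector2_in_mbr_iff
      by (auto simp: of_bool_def)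
    then show ?thesis
      by (simp only: vector2_eta)
  qed
  moreover have "(vector [0, 0] :: real^2) \<in> box (vector [- (1/4), - (1/4)]) (vector [1/4, 1/4])"
    by (simp add: mem_box_cart forall_2)
  ultimately show ?thesis
    unfolding max_region_def using location_weight_tight_le by blast
qed

text \<open>A disk about a corner can cover (x, y) only if the corner has positive inner product
  with (x, y). On a diagonal, two corners are orthogonal to (x, y) and the other two are opposite,
  so at most one qualifies.\<close>

lemma disk_weight_tight_le:
  assumes "\<bar>x\<bar> = \<bar>y\<bar>" and "\<bar>x\<bar> < 1"
  shows "disk_weight tight_objects tight_weight 2 (vector [x, y]) \<le> 1"
proof -
  have corner: "0 < x * a + y * b"
    if "(x - a)\<^sup>2 + (y - b)\<^sup>2 < 1" "a\<^sup>2 = 9/16" "b\<^sup>2 = 9/16" for a b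
  proof -
    have "x\<^sup>2 + y\<^sup>2 + a\<^sup>2 + b\<^sup>2 - 2 * (x * a + y * b) < 1"
      using that(1) by (simp add: power2_eq_square algebra_simps)
    \<comment> \<open>Here 1/8 = 9/16 + 9/16 - 1, the excess of the corner's squared norm over the
      squared radius.\<close>
    then have "1/8 < 2 * (x * a + y * b)"
      using that(2,3) sum_power2_ge_zero[of x y] by argo
    then show ?thesis
      by simp
  qed
  have c1: "(x - 3/4)\<^sup>2 + (y - 3/4)\<^sup>2 < 1 \<Longrightarrow> 0 < x + y"
    using corner[of "3/4" "3/4"] by (simp add: power2_eq_square)
  have c2: "(x - 3/4)\<^sup>2 + (y - - (3/4))\<^sup>2 < 1 \<Longrightarrow> y < x"
    using corner[of "3/4" "- (3/4)"] by (simp add: power2_eq_square)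
  have c3: "(x - - (3/4))\<^sup>2 + (y - 3/4)\<^sup>2 < 1 \<Longrightarrow> x < y"
    using corner[of "- (3/4)" "3/4"] by (simp add: power2_eq_square)
  have c4: "(x - - (3/4))\<^sup>2 + (y - - (3/4))\<^sup>2 < 1 \<Longrightarrow> x + y < 0"
    using corner[of "- (3/4)" "- (3/4)"] by (simp add: power2_eq_square)
  have "1 < \<bar>x - 10\<bar>"
    using assms(2) by linarith
  then have "1 < (x - 10)\<^sup>2"
    by (metis one_less_power pos2 power2_abs)
  then have far: "\<not> (x - 10)\<^sup>2 + (y - 10)\<^sup>2 < 1"
    using zero_le_power2[of "y - 10"] by linarith
  have "x = y \<or> x = - y"
    using assms(1) by linarith
  then show ?thesis
    unfolding disk_weight_def sum_tight_weight
    using c1 c2 c3 c4 far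
    by (auto simp: vector2_in_unit_ball_iff of_bool_def simp del: mem_ball split: if_splits)
qed

lemma maxcrs_opt_tight_ge: "4 \<le> maxcrs_opt tight_objects tight_weight 2"
proof -
  let ?f = "covered_weight tight_objects tight_weight 2"
  have "finite (range ?f)"
    by (rule finite_range_covered_weight) (simp add: tight_objects_def)
  then have "?f (vector [10, 10]) \<le> maxcrs_opt tight_objects tight_weight 2"
    unfolding maxcrs_opt_def by (intro Max_ge) auto
  moreover have "4 \<le> ?f (vector [10, 10])"
    unfolding covered_weight_def sum_tight_weight by simp
  ultimately show ?thesis
    by linarith
qed

text \<open>Both coordinates of a shifted point have absolute value |s| / sqrt 2; the coarser bound
  |s| also covers the center and already stays below the radius 1.\<close>

lemma tight_candidate_cases:
  assumes "q \<in> insert 0 (shifted_points s 0)"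
  obtains x y where "q = vector [x, y]" "\<bar>x\<bar> = \<bar>y\<bar>" "\<bar>x\<bar> \<le> \<bar>s\<bar>"
proof (cases "q = 0")
  case True
  then have "q = vector [0, 0]"
    by (simp add: vec_eq_iff forall_2)
  then show ?thesis
    using that by fastforce
next
  case False
  then obtain u v where uv: "q = vector [u * (s / sqrt 2), v * (s / sqrt 2)]"
    and "u \<in> {-1, 1}" "v \<in> {-1, 1}"
    using assms by (auto simp: shifted_points_def)
  then have "\<bar>u * (s / sqrt 2)\<bar> = \<bar>s\<bar> / sqrt 2" "\<bar>v * (s / sqrt 2)\<bar> = \<bar>s\<bar> / sqrt 2"
    by auto
  moreover have "\<bar>s\<bar> / sqrt 2 \<le> \<bar>s\<bar>"
    by (simp add: divide_le_eq mult_le_cancel_left1)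
  ultimately show ?thesis
    using that uv by metis
qed

lemma tight_returns:
  assumes "\<bar>s\<bar> < 1"
  obtains p where "approx_maxcrs_returns s tight_objects tight_weight 2 p"
    and "covered_weight tight_objects tight_weight 2 p \<le> 1"
proof -
  let ?C = "insert (0 :: real^2) (shifted_points s 0)"
  let ?f = "disk_weight tight_objects tight_weight 2"
  have "finite ?C"
    unfolding shifted_points_def by (intro finite.insertI finite_image_set2) auto
  \<comment> \<open>Any maximizer among the five candidates serves, since the bound 1 holds for each
    of them.\<close>
  then obtain p where p: "is_arg_max ?f (\<lambda>q. q \<in> ?C) p"
    using ex_is_arg_min_if_finite[of ?C "\<lambda>q. - ?f q"]
    by (auto simp: is_arg_min_def is_arg_max_def)
  have "midpoint (vector [- (1/4), - (1/4)]) (vector [1/4, 1/4]) = (0 :: real^2)"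
    by (simp add: midpoint_def vec_eq_iff forall_2)
  with p have "approx_maxcrs_returns s tight_objects tight_weight 2 p"
    unfolding approx_maxcrs_returns_def using max_region_tight by metis
  moreover have "p \<in> ?C"
    using p by (simp add: is_arg_max_def)
  then obtain x y where "p = vector [x, y]" "\<bar>x\<bar> = \<bar>y\<bar>" "\<bar>x\<bar> \<le> \<bar>s\<bar>"
    by (rule tight_candidate_cases)
  then have "?f p \<le> 1"
    using disk_weight_tight_le assms by auto
  ultimately show ?thesis
    using that by (simp add: covered_weight_eq_disk_weight)
qed

theorem theorem4:
  fixes \<sigma> :: "real \<Rightarrow> real"
  assumes "\<And>d. d > 0 \<Longrightarrow> (sqrt 2 - 1) * (d / 2) < \<sigma> d \<and> \<sigma> d < d / 2"
  shows "\<not> (\<exists>\<alpha>>1/4. \<forall>Obj w d. maxcrs_instance Obj w d \<longrightarrow>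
             (\<forall>p. approx_maxcrs_returns (\<sigma> d) Obj w d p \<longrightarrow>
                covered_weight Obj w d p \<ge> \<alpha> * maxcrs_opt Obj w d))"
proof
  assume "\<exists>\<alpha>>1/4. \<forall>Obj w d. maxcrs_instance Obj w d \<longrightarrow>
             (\<forall>p. approx_maxcrs_returns (\<sigma> d) Obj w d p \<longrightarrow>
                covered_weight Obj w d p \<ge> \<alpha> * maxcrs_opt Obj w d)"
  then obtain \<alpha> :: real where \<alpha>: "\<alpha> > 1/4"
    and ratio: "\<And>Obj w d p. maxcrs_instance Obj w d \<Longrightarrow> approx_maxcrs_returns (\<sigma> d) Obj w d p \<Longrightarrow>
      covered_weight Obj w d p \<ge> \<alpha> * maxcrs_opt Obj w d"
    by blast
  \<comment> \<open>For \<open>d = 2\<close> the radius \<open>d / 2\<close> is 1, so the admissible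
    shifts lie strictly between 0 and 1.\<close>
  have "1 < sqrt 2" "sqrt 2 - 1 < \<sigma> 2" "\<sigma> 2 < 1"
    using assms[of 2] by simp_all
  then have "\<bar>\<sigma> 2\<bar> < 1"
    by linarith
  then obtain p where p: "approx_maxcrs_returns (\<sigma> 2) tight_objects tight_weight 2 p"
    and le: "covered_weight tight_objects tight_weight 2 p \<le> 1"
    by (rule tight_returns)
  have "maxcrs_instance tight_objects tight_weight 2"
    by (simp add: maxcrs_instance_def tight_objects_def tight_weight_def)
  then have "\<alpha> * maxcrs_opt tight_objects tight_weight 2 \<le> 1"
    using ratio p le by fastforce
  \<comment> \<open>Combined with the previous bound this gives 4 * \<alpha> \<le> 1, against
    \<alpha> > 1/4.\<close>
  moreover have "\<alpha> * 4 \<le> \<alpha> * maxcrs_opt tight_objects tight_weight 2"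
    using \<alpha> maxcrs_opt_tight_ge by (intro mult_left_mono) auto
  ultimately show False
    using \<alpha> by linarith
qed

end
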